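(* Let $\nu$ be a locally finite Borel measure on $\mathbb{R}^d$ and $\rho$ a Borel probability measure on $\mathbb{R}^d$. Then $\dim(\nu*\rho)=\dim\nu$, where $\dim$ denotes the (upper) Beurling dimension.
   Context: Let $Q=[0,1)^d$. A Borel measure on $\mathbb{R}^d$ is locally finite if it is finite on compact sets. For a measure $\nu$ on $\mathbb{R}^d$ and $\alpha\ge 0$, the $\alpha$-upper Beurling density is $$\mathcal{D}_\alpha(\nu)=\limsup_{R\to\infty}\sup_{x\in\mathbb{R}^d}\frac{\nu(x+RQ)}{R^\alpha}\in[0,\infty],$$ and the (upper) Beurling dimension is $\dim\nu=\sup\{\alpha\ge 0:\mathcal{D}_\alpha(\nu)=\infty\}$, with the convention $\sup\emptyset=0$. *)

theory Defs
  imports "HOL-Probability.Probability"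
begin

definition locally_finite_borel_measure :: "(real ^ 'n) measure \<Rightarrow> bool" where
  "locally_finite_borel_measure \<nu> \<longleftrightarrow>
     sets \<nu> = sets borel \<and> (\<forall>K. compact K \<longrightarrow> emeasure \<nu> K < \<infinity>)"

definition unit_cube :: "(real ^ 'n) set" where
  "unit_cube = {q. \<forall>i. 0 \<le> q $ i \<and> q $ i < 1}"

(* Only large R matter in the upper limit, so the values for R \<le> 0 play no role. *)
definition upper_beurling_density :: "real \<Rightarrow> (real ^ 'n) measure \<Rightarrow> ennreal" where
  "upper_beurling_density \<alpha> \<nu> =
     Limsup at_top (\<lambda>R::real.
       SUP x. emeasure \<nu> ((\<lambda>q. x + R *\<^sub>R q) ` unit_cube) / ennreal (R powr \<alpha>))"

(* The supremum is taken in [0,\<infinity>], where Sup {} = 0; the value \<infinity> can occur,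
   since a locally finite measure need not be uniformly bounded on translates of a cube. *)
definition beurling_dim :: "(real ^ 'n) measure \<Rightarrow> ennreal" where
  "beurling_dim \<nu> = (SUP \<alpha>\<in>{\<alpha>::real. 0 \<le> \<alpha> \<and> upper_beurling_density \<alpha> \<nu> = \<infinity>}. ennreal \<alpha>)"

end

theory Submission
  imports Defs
begin

text \<open>
  Both inequalities compare how much mass \<open>\<nu>\<close> and \<open>\<nu> \<star> \<rho>\<close> can give to half-open cubes of a
  given side length. By Tonelli, the mass of a cube under \<open>\<nu> \<star> \<rho>\<close> is the \<open>\<rho>\<close>-average of the
  \<open>\<nu>\<close>-masses of its translates (lemma \<open>emeasure_convolution_half_open_cube\<close>). An average is at
  most the supremum, so \<open>\<nu> \<star> \<rho>\<close> gives no cube more mass than the supremum of the \<open>\<nu>\<close>-masses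
  of the cubes of that side length.

  Conversely, \<open>\<rho>\<close> puts at least half of its mass on some ball of radius \<open>N\<close> around the origin. A
  cube of side \<open>R\<close>, widened by \<open>N\<close> on every side, still contains the original cube after a
  translation by any vector of that ball. So \<open>\<nu> \<star> \<rho>\<close> gives the widened cube, of side
  \<open>R + 2 * N\<close>, at least half of the \<open>\<nu>\<close>-mass of the original one (lemma
  \<open>emeasure_cube_le_convolution\<close>).

  Neither a constant factor nor a bounded change of side length affects whether the masses grow at
  most like \<open>R powr \<alpha>\<close> (lemma \<open>upper_beurling_density_finite_transfer\<close>). So the densities of
  \<open>\<nu>\<close> and \<open>\<nu> \<star> \<rho>\<close> are infinite for the same exponents \<open>\<alpha> \<ge> 0\<close>, and the dimensions, being the
  suprema of these exponents, agree.
\<close>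

section \<open>Half-open cubes\<close>

definition half_open_cube :: "real ^ 'n \<Rightarrow> real \<Rightarrow> (real ^ 'n) set" where
  "half_open_cube x R = {z. \<forall>i. x $ i \<le> z $ i \<and> z $ i < x $ i + R}"

lemma scaled_unit_cube_eq:
  assumes "R > 0"
  shows "(\<lambda>q. x + R *\<^sub>R q) ` unit_cube = half_open_cube x R"
proof (intro equalityI subsetI)
  fix z assume "z \<in> (\<lambda>q. x + R *\<^sub>R q) ` unit_cube"
  then show "z \<in> half_open_cube x R"
    using assms by (auto simp: unit_cube_def half_open_cube_def)
next
  fix z assume z: "z \<in> half_open_cube x R"
  have "z = x + R *\<^sub>R ((1 / R) *\<^sub>R (z - x))"
    using assms by simp
  moreover have "(1 / R) *\<^sub>R (z - x) \<in> unit_cube"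
    using z assms by (auto simp: unit_cube_def half_open_cube_def field_simps)
  ultimately show "z \<in> (\<lambda>q. x + R *\<^sub>R q) ` unit_cube"
    by blast
qed

lemma half_open_cube_in_borel [measurable]: "half_open_cube x R \<in> sets borel"
proof -
  have "half_open_cube x R = (\<Inter>i. {z. x $ i \<le> z $ i} \<inter> {z. z $ i < x $ i + R})"
    by (auto simp: half_open_cube_def)
  moreover have "{z :: real ^ 'a. x $ i \<le> z $ i} \<inter> {z. z $ i < x $ i + R} \<in> sets borel" for i
    by (intro sets.Int borel_closed borel_open closed_Collect_le open_Collect_less continuous_intros)
  ultimately show ?thesis
    by (auto intro: sets.countable_INT)
qed

lemma half_open_cube_translate: "(\<lambda>z. z + y) -` half_open_cube x R = half_open_cube (x - y) R"
  by (auto simp: half_open_cube_def algebra_simps)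

section \<open>Finiteness of the upper density as a growth bound\<close>

text \<open>
  This replaces the upper limit of suprema by a growth bound that is uniform in the position of the
  cube.
\<close>

lemma upper_beurling_density_finite_iff:
  "upper_beurling_density \<alpha> \<nu> \<noteq> \<infinity> \<longleftrightarrow>
    (\<exists>C. \<forall>\<^sub>F R in at_top. \<forall>x. emeasure \<nu> (half_open_cube x R) \<le> ennreal (C * R powr \<alpha>))"
    (is "?L \<longleftrightarrow> ?R")
proof
  let ?f = "\<lambda>R. SUP x. emeasure \<nu> ((\<lambda>q. x + R *\<^sub>R q) ` unit_cube) / ennreal (R powr \<alpha>)"
  assume ?L
  then have "Limsup at_top ?f < \<infinity>"
    by (simp add: upper_beurling_density_def less_top)
  then obtain c where c: "Limsup at_top ?f < c" "c < \<infinity>"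
    using dense by blast
  then have "\<forall>\<^sub>F R in at_top. ?f R < c"
    by (intro Limsup_lessD)
  moreover have "\<forall>\<^sub>F R::real in at_top. R > 0"
    by (rule eventually_gt_at_top)
  ultimately have
    "\<forall>\<^sub>F R in at_top. \<forall>x. emeasure \<nu> (half_open_cube x R) \<le> ennreal (enn2real c * R powr \<alpha>)"
  proof eventually_elim
    case (elim R)
    show ?case
    proof
      fix x
      have "emeasure \<nu> (half_open_cube x R) / ennreal (R powr \<alpha>) \<le> ?f R"
        using elim by (intro SUP_upper2[where i = x]) (auto simp: scaled_unit_cube_eq)
      also have "\<dots> < c"
        using elim by simp
      finally have "emeasure \<nu> (half_open_cube x R) < c * ennreal (R powr \<alpha>)"
        using elim by (subst (asm) divide_less_ennreal) auto
      also have "\<dots> = ennreal (enn2real c * R powr \<alpha>)"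
        using c by (simp add: ennreal_mult)
      finally show "emeasure \<nu> (half_open_cube x R) \<le> ennreal (enn2real c * R powr \<alpha>)"
        by simp
    qed
  qed
  then show ?R
    by blast
next
  let ?f = "\<lambda>R. SUP x. emeasure \<nu> ((\<lambda>q. x + R *\<^sub>R q) ` unit_cube) / ennreal (R powr \<alpha>)"
  assume ?R
  then obtain C where
    "\<forall>\<^sub>F R in at_top. \<forall>x. emeasure \<nu> (half_open_cube x R) \<le> ennreal (C * R powr \<alpha>)"
    by blast
  moreover have "\<forall>\<^sub>F R::real in at_top. R > 0"
    by (rule eventually_gt_at_top)
  ultimately have "\<forall>\<^sub>F R in at_top. ?f R \<le> ennreal C"
  proof eventually_elim
    case (elim R)
    have "emeasure \<nu> (half_open_cube x R) / ennreal (R powr \<alpha>) \<le> ennreal C" for x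
    proof (rule divide_le_posI_ennreal)
      show "ennreal (R powr \<alpha>) > 0"
        using elim by simp
      show "emeasure \<nu> (half_open_cube x R) \<le> ennreal (R powr \<alpha>) * ennreal C"
        using elim by (simp add: mult.commute[of C] ennreal_mult')
    qed
    then show ?case
      using elim by (intro SUP_least) (simp add: scaled_unit_cube_eq)
  qed
  then have "upper_beurling_density \<alpha> \<nu> \<le> ennreal C"
    unfolding upper_beurling_density_def by (rule Limsup_bounded)
  also have "\<dots> < \<infinity>"
    by simp
  finally show ?L
    by simp
qed

text \<open>
  The bounded enlargement by \<open>a\<close> is harmless: \<open>R + a \<le> 2 * R\<close> once \<open>R \<ge> a\<close>, so it costs at most a
  factor \<open>2 powr \<alpha>\<close>. The comparison is phrased through a common upper bound \<open>M\<close> because the cube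
  on the right need not be a specific one.
\<close>

lemma upper_beurling_density_finite_transfer:
  fixes \<mu> \<nu> :: "(real ^ 'n) measure"
  assumes "\<alpha> \<ge> 0" "a \<ge> 0" "K \<ge> 0"
    and compare: "\<And>x R M. R > 0 \<Longrightarrow> (\<And>z. emeasure \<mu> (half_open_cube z (R + a)) \<le> M) \<Longrightarrow>
      emeasure \<nu> (half_open_cube x R) \<le> ennreal K * M"
    and "upper_beurling_density \<alpha> \<mu> \<noteq> \<infinity>"
  shows "upper_beurling_density \<alpha> \<nu> \<noteq> \<infinity>"
proof -
  obtain C where C:
    "\<forall>\<^sub>F R in at_top. \<forall>x. emeasure \<mu> (half_open_cube x R) \<le> ennreal (C * R powr \<alpha>)"
    using assms(5) unfolding upper_beurling_density_finite_iff by blast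
  have "filterlim (\<lambda>R. R + a) at_top at_top"
    using assms by (intro filterlim_at_top_mono[OF filterlim_ident]) auto
  then have "\<forall>\<^sub>F R in at_top. \<forall>x. emeasure \<mu> (half_open_cube x (R + a)) \<le> ennreal (C * (R + a) powr \<alpha>)"
    using C by (rule eventually_compose_filterlim[rotated])
  moreover have "\<forall>\<^sub>F R in at_top. R > 0 \<and> R \<ge> a"
    by (intro eventually_conj eventually_gt_at_top eventually_ge_at_top)
  ultimately have "\<forall>\<^sub>F R in at_top. \<forall>x. emeasure \<nu> (half_open_cube x R)
      \<le> ennreal ((K * max 0 C * 2 powr \<alpha>) * R powr \<alpha>)"
  proof eventually_elim
    case (elim R)
    show ?case
    proof
      fix x
      \<comment> \<open>\<open>C\<close> may be negative, and then enlarging the power would lower the bound.\<close>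
      have "C * (R + a) powr \<alpha> \<le> max 0 C * (2 * R) powr \<alpha>"
        using elim assms by (intro mult_mono powr_mono2) auto
      then have "emeasure \<mu> (half_open_cube z (R + a)) \<le> ennreal (max 0 C * (2 * R) powr \<alpha>)" for z
        using elim by (meson ennreal_leI order_trans)
      then have "emeasure \<nu> (half_open_cube x R) \<le> ennreal K * ennreal (max 0 C * (2 * R) powr \<alpha>)"
        using elim by (intro compare) auto
      also have "\<dots> = ennreal ((K * max 0 C * 2 powr \<alpha>) * R powr \<alpha>)"
        using elim assms by (simp flip: ennreal_mult' add: powr_mult mult_ac)
      finally show "emeasure \<nu> (half_open_cube x R)
          \<le> ennreal ((K * max 0 C * 2 powr \<alpha>) * R powr \<alpha>)" .
    qed
  qed
  then show ?thesis
    unfolding upper_beurling_density_finite_iff by blast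
qed

section \<open>Convolution masses of cubes\<close>

lemma locally_finite_sigma_finite:
  assumes "locally_finite_borel_measure \<nu>"
  shows "sigma_finite_measure \<nu>"
proof
  let ?A = "range (\<lambda>n::nat. cball 0 (real n))"
  have "\<Union>?A = UNIV"
    using real_arch_simple by auto
  then show "\<exists>A. countable A \<and> A \<subseteq> sets \<nu> \<and> \<Union>A = space \<nu> \<and> (\<forall>a\<in>A. emeasure \<nu> a \<noteq> \<infinity>)"
    using assms unfolding locally_finite_borel_measure_def
    by (intro exI[of _ ?A]) (auto simp: less_top sets_eq_imp_space_eq)
qed

text \<open>
  This is Tonelli's theorem for the indicator of the cube pulled back along addition. Assuming only
  \<open>\<sigma>\<close>-finiteness admits measures \<open>\<nu>\<close> of infinite total mass, such as Lebesgue measure.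
\<close>

lemma emeasure_convolution_half_open_cube:
  fixes \<nu> \<rho> :: "(real ^ 'n) measure"
  assumes "sigma_finite_measure \<nu>" "sigma_finite_measure \<rho>"
    and [measurable_cong]: "sets \<nu> = sets borel" "sets \<rho> = sets borel"
  shows "emeasure (\<nu> \<star> \<rho>) (half_open_cube x R) =
    (\<integral>\<^sup>+y. emeasure \<nu> (half_open_cube (x - y) R) \<partial>\<rho>)"
proof -
  interpret \<nu>: sigma_finite_measure \<nu> by fact
  interpret \<rho>: sigma_finite_measure \<rho> by fact
  interpret pair_sigma_finite \<nu> \<rho> ..
  let ?S = "(\<lambda>(u, v). u + v) -` half_open_cube x R \<inter> space (\<nu> \<Otimes>\<^sub>M \<rho>)"
  have space: "space \<nu> = UNIV" "space \<rho> = UNIV"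
    using assms(3,4)[THEN sets_eq_imp_space_eq] by auto
  have "emeasure (\<nu> \<star> \<rho>) (half_open_cube x R) = emeasure (\<nu> \<Otimes>\<^sub>M \<rho>) ?S"
    unfolding convolution_def by (rule emeasure_distr) measurable
  also have "\<dots> = (\<integral>\<^sup>+y. emeasure \<nu> ((\<lambda>u. (u, y)) -` ?S) \<partial>\<rho>)"
    by (rule emeasure_pair_measure_alt2) measurable
  also have "\<dots> = (\<integral>\<^sup>+y. emeasure \<nu> (half_open_cube (x - y) R) \<partial>\<rho>)"
    unfolding half_open_cube_translate[symmetric]
    by (intro nn_integral_cong arg_cong[where f = "emeasure \<nu>"])
      (auto simp: space_pair_measure space)
  finally show ?thesis .
qed

lemma prob_space_half_mass_cball:
  fixes \<rho> :: "('a :: real_normed_vector) measure"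
  assumes "prob_space \<rho>" and sets: "sets \<rho> = sets borel"
  obtains N :: nat where "emeasure \<rho> (cball 0 (real N)) \<ge> ennreal (1 / 2)"
proof -
  interpret prob_space \<rho> by fact
  let ?B = "\<lambda>n::nat. cball (0::'a) (real n)"
  have "(\<lambda>n. measure \<rho> (?B n)) \<longlonglongrightarrow> measure \<rho> (\<Union>n. ?B n)"
    by (rule finite_Lim_measure_incseq) (auto simp: sets incseq_def)
  also have "(\<Union>n. ?B n) = space \<rho>"
    using real_arch_simple sets_eq_imp_space_eq[OF sets] by auto
  finally have "(\<lambda>n. measure \<rho> (?B n)) \<longlonglongrightarrow> 1"
    by (simp add: prob_space)
  then have "\<forall>\<^sub>F n in sequentially. measure \<rho> (?B n) > 1 / 2"
    by (rule order_tendstoD) simp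
  then obtain N where "measure \<rho> (?B N) > 1 / 2"
    using eventually_happens'[OF sequentially_bot] by blast
  then show ?thesis
    by (intro that[of N], unfold emeasure_eq_measure) (intro ennreal_leI less_imp_le)
qed

lemma half_open_cube_subset_widened_translate:
  fixes x y :: "real ^ 'n"
  assumes "norm y \<le> N"
  shows "half_open_cube x R \<subseteq> half_open_cube (x - (\<chi> i. N) - y) (R + 2 * N)"
proof
  fix z assume z: "z \<in> half_open_cube x R"
  have "\<bar>y $ i\<bar> \<le> N" for i
    using component_le_norm_cart[of y i] assms by simp
  then have "- N \<le> y $ i \<and> y $ i \<le> N" for i
    by (metis abs_le_iff minus_le_iff)
  then show "z \<in> half_open_cube (x - (\<chi> i. N) - y) (R + 2 * N)"
    using z unfolding half_open_cube_def by (auto; smt (verit))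
qed

text \<open>
  Only the vectors in the ball are kept in Tonelli's integral; each of them contributes at least the
  mass of the original cube.
\<close>

lemma emeasure_cube_le_convolution:
  fixes \<nu> \<rho> :: "(real ^ 'n) measure"
  assumes "sigma_finite_measure \<nu>" "sigma_finite_measure \<rho>"
    and sets: "sets \<nu> = sets borel" "sets \<rho> = sets borel"
  shows "emeasure \<nu> (half_open_cube x R) * emeasure \<rho> (cball 0 N)
    \<le> emeasure (\<nu> \<star> \<rho>) (half_open_cube (x - (\<chi> i. N)) (R + 2 * N))"
proof -
  have "emeasure \<nu> (half_open_cube x R) * emeasure \<rho> (cball 0 N) =
      (\<integral>\<^sup>+y. emeasure \<nu> (half_open_cube x R) * indicator (cball 0 N) y \<partial>\<rho>)"
    by (simp add: nn_integral_cmult_indicator sets)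
  also have "\<dots> \<le> (\<integral>\<^sup>+y. emeasure \<nu> (half_open_cube (x - (\<chi> i. N) - y) (R + 2 * N)) \<partial>\<rho>)"
    by (intro nn_integral_mono)
      (auto simp: sets split: split_indicator
        intro!: emeasure_mono half_open_cube_subset_widened_translate)
  also have "\<dots> = emeasure (\<nu> \<star> \<rho>) (half_open_cube (x - (\<chi> i. N)) (R + 2 * N))"
    by (rule emeasure_convolution_half_open_cube[symmetric]) fact+
  finally show ?thesis .
qed

section \<open>Invariance of the Beurling dimension\<close>

theorem theorem3p4:
  fixes \<nu> \<rho> :: "(real ^ 'n) measure"
  assumes "locally_finite_borel_measure \<nu>"
    and "prob_space \<rho>" and "sets \<rho> = sets borel"
  shows "beurling_dim (\<nu> \<star> \<rho>) = beurling_dim \<nu>"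
proof -
  interpret \<rho>: prob_space \<rho> by fact
  have sets: "sets \<nu> = sets borel" "sets \<rho> = sets borel"
    using assms by (auto simp: locally_finite_borel_measure_def)
  have sigma: "sigma_finite_measure \<nu>" "sigma_finite_measure \<rho>"
    using assms locally_finite_sigma_finite by (auto intro: \<rho>.sigma_finite_measure)
  obtain N :: nat where N: "emeasure \<rho> (cball 0 (real N)) \<ge> ennreal (1 / 2)"
    using prob_space_half_mass_cball assms by blast

  have average_le: "emeasure (\<nu> \<star> \<rho>) (half_open_cube x R) \<le> ennreal 1 * M"
    if "\<And>z. emeasure \<nu> (half_open_cube z (R + 0)) \<le> M" for x R M
  proof -
    have "emeasure (\<nu> \<star> \<rho>) (half_open_cube x R) \<le> (\<integral>\<^sup>+y. M \<partial>\<rho>)"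
      unfolding emeasure_convolution_half_open_cube[OF sigma sets]
      using that by (intro nn_integral_mono) simp
    then show ?thesis
      by (simp add: \<rho>.emeasure_space_1)
  qed

  have le_widened: "emeasure \<nu> (half_open_cube x R) \<le> ennreal 2 * M"
    if "\<And>z. emeasure (\<nu> \<star> \<rho>) (half_open_cube z (R + 2 * real N)) \<le> M" for x R M
  proof -
    let ?m = "emeasure \<nu> (half_open_cube x R)"
    have "ennreal 2 * ennreal (1 / 2) = 1"
      by (subst ennreal_mult'[symmetric]) auto
    then have "?m = ennreal 2 * (?m * ennreal (1 / 2))"
      by (metis mult.left_commute mult.right_neutral)
    also have "?m * ennreal (1 / 2) \<le> ?m * emeasure \<rho> (cball 0 (real N))"
      using N by (intro mult_left_mono) auto
    also have "\<dots> \<le> M"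
      using emeasure_cube_le_convolution[OF sigma sets] that by (rule order_trans)
    finally show ?thesis
      by (simp add: mult_left_mono)
  qed

  have "upper_beurling_density \<alpha> (\<nu> \<star> \<rho>) = \<infinity> \<longleftrightarrow> upper_beurling_density \<alpha> \<nu> = \<infinity>"
    if "\<alpha> \<ge> 0" for \<alpha>
    using upper_beurling_density_finite_transfer[OF that, of 0 1 \<nu> "\<nu> \<star> \<rho>"] average_le
      upper_beurling_density_finite_transfer[OF that, of "2 * real N" 2 "\<nu> \<star> \<rho>" \<nu>] le_widened
    by auto
  then show ?thesis
    unfolding beurling_dim_def by (intro SUP_cong) auto
qed

end
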